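(* Let $f(x)=a_nx^n+\dots+a_0$ be a polynomial of degree $n\ge1$ with integer coefficients that is expansive, and let $\alpha$ be any root of $f$. Then \[ \frac{1}{|\alpha|-1}\le\begin{cases}nL(f)+n & \text{if }\alpha\in\mathbb{R},\\ 2\binom{n}{2}L(f)^{n-1}+2\binom{n}{2}+1 & \text{if }\alpha\in\mathbb{C}\setminus\mathbb{R}.\end{cases}\]
   Context: A polynomial is expansive if all of its complex roots $\alpha$ satisfy $|\alpha|>1$. The length of $f$ is $L(f)=\sum_{i=0}^n|a_i|$. *)

theory Defs
  imports "HOL-Analysis.Analysis" "HOL-Computational_Algebra.Computational_Algebra"
begin

definition expansive :: "complex poly \<Rightarrow> bool" where
  "expansive p \<longleftrightarrow> (\<forall>z. poly p z = 0 \<longrightarrow> norm z > 1)"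

definition poly_length :: "int poly \<Rightarrow> int" where
  "poly_length f = (\<Sum>i\<le>degree f. \<bar>coeff f i\<bar>)"

end

theory Submission
  imports Defs "HOL-Computational_Algebra.Field_as_Ring" "Jordan_Normal_Form.Determinant"
begin

text \<open>
  In each case a nonzero integer is bounded above by a multiple of a quantity that vanishes at
  \<open>|\<alpha>| = 1\<close>.

  For real \<open>\<alpha>\<close> the integer is \<open>f(\<plusminus>1)\<close>: comparing \<open>f(sgn \<alpha>)\<close> with \<open>|\<alpha>|\<^bsup>-n\<^esup> f(\<alpha>) = 0\<close> term by
  term gives \<open>1 \<le> n L(f) (1 - 1/|\<alpha>|)\<close>.

  For nonreal \<open>\<alpha>\<close> put \<open>d = n - 1\<close> and let \<open>T(s)\<close> be the \<open>d \<times> d\<close> matrix with rows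
  \<open>k = 0, ..., d - 1\<close> that sends the coefficients of a polynomial \<open>U\<close> of degree less than \<open>d\<close> to
  \<open>s\<^bsup>d-k\<^esup> [x\<^bsup>k\<^esup>] f U - [x\<^bsup>2d-k\<^esup>] f U\<close>. Its determinant is, up to normalisation,
  \<open>\<Prod>\<^bsub>i<j\<^esub> (1 - s \<alpha>\<^sub>i \<alpha>\<^sub>j)\<close>, but only two values of \<open>s\<close> matter. A kernel vector of \<open>T(1)\<close> makes
  \<open>f U\<close> palindromic, so \<open>f\<close> divides the product of its coprime reversal with a polynomial of degree
  less than \<open>n\<close>, which is impossible; thus \<open>det T(1)\<close> is a nonzero integer. With
  \<open>f = (x - \<alpha>) (x - cnj \<alpha>) h\<close> and \<open>t = |\<alpha>|\<^sup>2\<close>, the polynomial \<open>U = x\<^bsup>n-2\<^esup> h(t/x)\<close> is a kernel vector of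
  \<open>T(1/t)\<close>. Since the columns of \<open>T\<close> have absolute sum at most \<open>L(f)\<close>, the Leibniz formula gives
  \<open>1 \<le> |det T(1) - det T(1/t)| \<le> (n choose 2) L(f)\<^bsup>n-1\<^esup> (1 - 1/t)\<close>.
\<close>

no_notation fps_nth (infixl "$" 75) and vec_nth (infixl "$" 90)

section \<open>Perturbation bounds for products and determinants\<close>

lemma one_minus_power_le:
  fixes s :: real
  assumes "0 \<le> s" "s \<le> 1"
  shows "1 - s ^ k \<le> real k * (1 - s)"
  using Bernoulli_inequality[of "s - 1" k] assms by (simp add: algebra_simps)

text \<open>Telescoping: one factor is exchanged at a time. The scaled product obeys the same bound
  as the unscaled one because each \<open>s i\<close> lies in the closed unit disc.\<close>

lemma norm_prod_scaled_diff_le: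
  fixes A B s :: "'i \<Rightarrow> complex"
  assumes "finite I" "\<And>i. i \<in> I \<Longrightarrow> norm (s i) \<le> 1"
  shows "norm ((\<Prod>i\<in>I. A i - B i) - (\<Prod>i\<in>I. A i * s i - B i))
     \<le> (\<Sum>i\<in>I. norm (1 - s i)) * (\<Prod>i\<in>I. norm (A i) + norm (B i))"
  using assms
proof (induction I rule: finite_induct)
  case empty
  then show ?case by simp
next
  case (insert j I)
  let ?P = "\<Prod>i\<in>I. A i - B i" and ?P' = "\<Prod>i\<in>I. A i * s i - B i"
  let ?Q = "\<Prod>i\<in>I. norm (A i) + norm (B i)" and ?S = "\<Sum>i\<in>I. norm (1 - s i)"
  have IH: "norm (?P - ?P') \<le> ?S * ?Q"
    using insert by simp
  have Q: "norm ?P' \<le> ?Q"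
    unfolding prod_norm[symmetric]
  proof (intro prod_mono conjI norm_ge_zero)
    fix i assume "i \<in> I"
    then have "norm (s i) \<le> 1" using insert.prems by simp
    then have "norm (A i * s i) \<le> norm (A i)"
      by (simp add: norm_mult mult_left_le)
    then show "norm (A i * s i - B i) \<le> norm (A i) + norm (B i)"
      using norm_triangle_ineq4[of "A i * s i" "B i"] by linarith
  qed
  have Q0: "0 \<le> ?Q" by (intro prod_nonneg) auto
  have eq: "(A j - B j) * ?P - (A j * s j - B j) * ?P'
      = (A j - B j) * (?P - ?P') + A j * (1 - s j) * ?P'"
    by (simp add: algebra_simps)
  have "norm ((A j - B j) * ?P - (A j * s j - B j) * ?P')
      \<le> norm (A j - B j) * norm (?P - ?P') + norm (A j) * norm (1 - s j) * norm ?P'"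
    unfolding eq by (rule order.trans[OF norm_triangle_ineq]) (simp add: norm_mult)
  also have "\<dots> \<le> (norm (A j) + norm (B j)) * (?S * ?Q)
      + (norm (A j) + norm (B j)) * norm (1 - s j) * ?Q"
    using IH Q Q0 by (intro add_mono mult_mono norm_triangle_ineq4) auto
  also have "\<dots> = (norm (1 - s j) + ?S) * ((norm (A j) + norm (B j)) * ?Q)"
    by (simp add: algebra_simps)
  finally show ?case using insert.hyps by simp
qed

text \<open>The Leibniz formula is expanded along columns while the scaling acts on rows, so every
  permutation collects the same total \<open>norm (1 - s k)\<close>. The remaining products, summed
  over permutations, are at most the product of the column sums, which avoids a factor
  \<open>d!\<close>.\<close>

lemma norm_det_scaled_diff_le:
  fixes A B :: "nat \<Rightarrow> nat \<Rightarrow> complex" and s :: "nat \<Rightarrow> complex"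
  assumes s: "\<And>k. k < d \<Longrightarrow> norm (s k) \<le> 1"
    and col: "\<And>m. m < d \<Longrightarrow> (\<Sum>k<d. norm (A k m) + norm (B k m)) \<le> L"
  shows "norm (Determinant.det (mat d d (\<lambda>(k, m). A k m - B k m))
      - Determinant.det (mat d d (\<lambda>(k, m). A k m * s k - B k m)))
     \<le> (\<Sum>k<d. norm (1 - s k)) * L ^ d"
proof -
  let ?P = "{p. p permutes {0..<d}}"
  let ?S = "\<Sum>k<d. norm (1 - s k)"
  let ?C = "\<lambda>p. \<Prod>m<d. norm (A (p m) m) + norm (B (p m) m)"
  have in_range: "p m < d" if "p \<in> ?P" "m < d" for p m
    using that permutes_in_image[of p "{0..<d}" m] by simp
  have det1: "Determinant.det (mat d d (\<lambda>(k, m). A k m - B k m))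
      = (\<Sum>p\<in>?P. signof p * (\<Prod>m<d. A (p m) m - B (p m) m))"
    by (subst det_col[of _ d]) (auto intro!: sum.cong prod.cong simp: in_range)
  have det2: "Determinant.det (mat d d (\<lambda>(k, m). A k m * s k - B k m))
      = (\<Sum>p\<in>?P. signof p * (\<Prod>m<d. A (p m) m * s (p m) - B (p m) m))"
    by (subst det_col[of _ d]) (auto intro!: sum.cong prod.cong simp: in_range)
  have term_le: "norm (signof p * (\<Prod>m<d. A (p m) m - B (p m) m)
      - signof p * (\<Prod>m<d. A (p m) m * s (p m) - B (p m) m)) \<le> ?S * ?C p" if p: "p \<in> ?P" for p
  proof -
    have "norm (signof p * (\<Prod>m<d. A (p m) m - B (p m) m)
      - signof p * (\<Prod>m<d. A (p m) m * s (p m) - B (p m) m))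
      = norm ((\<Prod>m<d. A (p m) m - B (p m) m) - (\<Prod>m<d. A (p m) m * s (p m) - B (p m) m))"
      by (simp add: sign_def norm_minus_commute)
    also have "\<dots> \<le> (\<Sum>m<d. norm (1 - s (p m))) * ?C p"
      using s in_range[OF p] by (intro norm_prod_scaled_diff_le) auto
    also have "(\<Sum>m<d. norm (1 - s (p m))) = ?S"
      using p sum.permute[of p "{0..<d}" "\<lambda>k. norm (1 - s k)"]
      by (simp add: o_def atLeast0LessThan)
    finally show ?thesis .
  qed
  \<comment> \<open>Members of \<open>PiE\<close> are undefined outside the index set, so
    permutations must be restricted first. Nothing is lost, since they are the identity
    there.\<close>
  have inj: "inj_on (\<lambda>p. restrict p {..<d}) ?P"
  proof (rule inj_onI)
    fix p q assume p: "p \<in> ?P" and q: "q \<in> ?P" and eq: "restrict p {..<d} = restrict q {..<d}"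
    show "p = q"
    proof
      fix x
      show "p x = q x"
      proof (cases "x < d")
        case True
        then show ?thesis using fun_cong[OF eq, of x] by simp
      next
        case False
        then show ?thesis using p q by (simp add: permutes_def)
      qed
    qed
  qed
  have "(\<Sum>p\<in>?P. ?C p) = (\<Sum>g\<in>(\<lambda>p. restrict p {..<d}) ` ?P. ?C g)"
    by (subst sum.reindex[OF inj]) (auto intro!: sum.cong prod.cong)
  \<comment> \<open>Enlarging from permutations to all self-maps of the index set lets the sum
    factor column by column.\<close>
  also have "\<dots> \<le> (\<Sum>g\<in>PiE {..<d} (\<lambda>_. {..<d}). ?C g)"
  proof (intro sum_mono2 finite_PiE)
    show "(\<lambda>p. restrict p {..<d}) ` ?P \<subseteq> PiE {..<d} (\<lambda>_. {..<d})"
      using in_range by (auto simp only: image_subset_iff restrict_PiE_iff lessThan_iff)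
  qed (simp_all add: prod_nonneg)
  also have "\<dots> = (\<Prod>m<d. \<Sum>k<d. norm (A k m) + norm (B k m))"
    by (simp add: prod_sum_PiE)
  also have "\<dots> \<le> (\<Prod>m<d. L)"
    using col by (intro prod_mono conjI sum_nonneg) auto
  finally have C: "(\<Sum>p\<in>?P. ?C p) \<le> L ^ d" by simp
  have "norm (Determinant.det (mat d d (\<lambda>(k, m). A k m - B k m))
      - Determinant.det (mat d d (\<lambda>(k, m). A k m * s k - B k m))) \<le> (\<Sum>p\<in>?P. ?S * ?C p)"
    unfolding det1 det2 sum_subtractf[symmetric]
    by (intro order.trans[OF norm_sum] sum_mono term_le)
  also have "\<dots> \<le> ?S * L ^ d"
    unfolding sum_distrib_left[symmetric] using C by (intro mult_left_mono sum_nonneg) auto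
  finally show ?thesis .
qed

section \<open>The matrix T(s) and its action on coefficient vectors\<close>

text \<open>
  The guard is needed because natural subtraction truncates; the indices \<open>2 * d - k - m\<close> of
  \<open>jury_mat\<close> need none, as \<open>k, m < d\<close>.
\<close>

definition jury_lower :: "'a::zero poly \<Rightarrow> nat \<Rightarrow> nat \<Rightarrow> 'a" where
  "jury_lower f k m = (if m \<le> k then coeff f (k - m) else 0)"

definition jury_mat :: "'a::comm_ring_1 poly \<Rightarrow> nat \<Rightarrow> 'a \<Rightarrow> 'a mat" where
  "jury_mat f d s = mat d d (\<lambda>(k, m). jury_lower f k m * s ^ (d - k) - coeff f (2 * d - k - m))"

lemma coeff_mult_eq_sum_jury_lower:
  fixes f U :: "'a::comm_ring_1 poly"
  assumes "\<And>m. m \<ge> d \<Longrightarrow> coeff U m = 0"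
  shows "coeff (f * U) k = (\<Sum>m<d. jury_lower f k m * coeff U m)"
proof -
  have "coeff (f * U) k = (\<Sum>m\<le>k. coeff f (k - m) * coeff U m)"
    by (subst mult.commute) (simp add: coeff_mult mult.commute)
  also have "\<dots> = (\<Sum>m\<in>{..k} \<inter> {..<d}. coeff f (k - m) * coeff U m)"
    using assms by (intro sum.mono_neutral_right) (auto simp flip: not_le)
  also have "\<dots> = (\<Sum>m\<in>{..<d} \<inter> {..k}. jury_lower f k m * coeff U m)"
    by (intro sum.cong) (auto simp: jury_lower_def)
  also have "\<dots> = (\<Sum>m<d. jury_lower f k m * coeff U m)"
    by (intro sum.mono_neutral_left) (auto simp: jury_lower_def)
  finally show ?thesis .
qed

lemma jury_mat_mult_vec_coeff:
  fixes f U :: "'a::comm_ring_1 poly"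
  assumes "\<And>m. m \<ge> d \<Longrightarrow> coeff U m = 0" and k: "k < d"
  shows "(jury_mat f d s *\<^sub>v vec d (coeff U)) $ k
     = coeff (f * U) k * s ^ (d - k) - coeff (f * U) (2 * d - k)"
proof -
  have "(jury_mat f d s *\<^sub>v vec d (coeff U)) $ k
      = (\<Sum>m<d. (jury_lower f k m * s ^ (d - k) - coeff f (2 * d - k - m)) * coeff U m)"
    using k by (auto simp: jury_mat_def scalar_prod_def atLeast0LessThan intro!: sum.cong)
  \<comment> \<open>For row \<open>2 * d - k\<close> the guard in \<open>jury_lower\<close> always
    holds, because \<open>m < d < 2 * d - k\<close>; hence both parts are convolution sums.\<close>
  also have "\<dots> = (\<Sum>m<d. jury_lower f k m * coeff U m * s ^ (d - k))
      - (\<Sum>m<d. jury_lower f (2 * d - k) m * coeff U m)"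
    unfolding sum_subtractf[symmetric] using k
    by (intro sum.cong) (auto simp: jury_lower_def algebra_simps)
  finally show ?thesis
    by (simp add: coeff_mult_eq_sum_jury_lower[OF assms(1)] sum_distrib_right)
qed

lemma jury_column_sum_le:
  fixes f :: "int poly"
  assumes m: "m < d" and deg: "degree f \<le> d + 1"
  shows "(\<Sum>k<d. \<bar>jury_lower f k m\<bar> + \<bar>coeff f (2 * d - k - m)\<bar>) \<le> poly_length f"
proof -
  have "(\<Sum>k<d. \<bar>jury_lower f k m\<bar>) = (\<Sum>k\<in>{m..<d}. \<bar>coeff f (k - m)\<bar>)"
    by (intro sum.mono_neutral_cong_right) (auto simp: jury_lower_def)
  also have "\<dots> = (\<Sum>i\<in>{..<d - m}. \<bar>coeff f i\<bar>)"
    using m by (intro sum.reindex_bij_witness[of _ "\<lambda>i. i + m" "\<lambda>k. k - m"]) auto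
  finally have A: "(\<Sum>k<d. \<bar>jury_lower f k m\<bar>) = (\<Sum>i\<in>{..<d - m}. \<bar>coeff f i\<bar>)" .
  have B: "(\<Sum>k<d. \<bar>coeff f (2 * d - k - m)\<bar>) = (\<Sum>i\<in>{d - m<..2 * d - m}. \<bar>coeff f i\<bar>)"
    using m by (intro sum.reindex_bij_witness[of _ "\<lambda>i. 2 * d - m - i" "\<lambda>k. 2 * d - k - m"]) auto
  \<comment> \<open>The index ranges of the two parts of a column are disjoint; those of a row may overlap.\<close>
  have "(\<Sum>k<d. \<bar>jury_lower f k m\<bar> + \<bar>coeff f (2 * d - k - m)\<bar>)
      = (\<Sum>i\<in>{..<d - m} \<union> {d - m<..2 * d - m}. \<bar>coeff f i\<bar>)"
    unfolding sum.distrib A B by (subst sum.union_disjoint) auto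
  \<comment> \<open>The upper limit is chosen to cover both the indices in the column and all
    coefficients of \<open>f\<close>.\<close>
  also have "\<dots> \<le> (\<Sum>i\<in>{..2 * d + degree f}. \<bar>coeff f i\<bar>)"
    by (intro sum_mono2) auto
  also have "\<dots> = poly_length f"
    unfolding poly_length_def by (intro sum.mono_neutral_right) (auto simp: coeff_eq_0)
  finally show ?thesis .
qed

section \<open>Nonvanishing of the determinant at s = 1\<close>

text \<open>A nontrivial gcd would have a complex root z; then z and 1/z would both be roots of
  \<open>f\<close>, hence both outside the closed unit disc.\<close>

lemma coprime_reflect_poly_if_expansive:
  assumes "expansive f"
  shows "coprime f (reflect_poly f)"
proof (rule ccontr)
  assume nc: "\<not> coprime f (reflect_poly f)"
  have f0: "f \<noteq> 0" using assms[unfolded expansive_def, rule_format, of 0] by auto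
  have "\<exists>z. poly (gcd f (reflect_poly f)) z = 0"
  proof (rule ccontr)
    assume "\<not> ?thesis"
    then have "constant (poly (gcd f (reflect_poly f)))"
      using fundamental_theorem_of_algebra by blast
    then have "degree (gcd f (reflect_poly f)) = 0"
      by (simp add: constant_degree)
    moreover have "gcd f (reflect_poly f) \<noteq> 0" using f0 by simp
    ultimately have "is_unit (gcd f (reflect_poly f))"
      by (subst is_unit_iff_degree) auto
    then show False using nc by (simp only: is_unit_gcd)
  qed
  then obtain z where z: "poly (gcd f (reflect_poly f)) z = 0" by blast
  have z1: "poly f z = 0" and z2: "poly (reflect_poly f) z = 0"
    using z by (metis gcd_dvd1 dvdE poly_mult mult_zero_left)
      (metis z gcd_dvd2 dvdE poly_mult mult_zero_left)
  have nz: "norm z > 1" using z1 assms by (simp add: expansive_def)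
  then have "z \<noteq> 0" by auto
  then have "poly f (inverse z) = 0"
    using z2 by (simp add: poly_reflect_poly_nz)
  then have "norm (inverse z) > 1" using assms by (simp add: expansive_def)
  then show False using nz by (simp add: norm_inverse one_less_inverse_iff)
qed

lemma det_jury_mat_one_nonzero:
  assumes exp: "expansive f" and deg: "degree f = d + 1"
  shows "Determinant.det (jury_mat f d 1) \<noteq> 0"
proof
  assume "Determinant.det (jury_mat f d 1) = 0"
  then obtain v where v: "v \<in> carrier_vec d" "v \<noteq> 0\<^sub>v d" "jury_mat f d 1 *\<^sub>v v = 0\<^sub>v d"
    using det_0_iff_vec_prod_zero[of "jury_mat f d 1" d] by (auto simp: jury_mat_def)
  define U where "U = (\<Sum>m<d. monom (v $ m) m)"
  \<comment> \<open>The reversal of \<open>U\<close> at formal degree \<open>d - 1\<close>;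
    \<open>reflect_poly\<close> would reverse at the actual degree, which may be smaller.\<close>
  define V where "V = (\<Sum>m<d. monom (v $ m) (d - 1 - m))"
  have cU: "coeff U m = (if m < d then v $ m else 0)" for m
    by (auto simp: U_def coeff_sum)
  have cU0: "coeff U m = 0" if "m \<ge> d" for m using that by (simp add: cU)
  have vU: "v = vec d (coeff U)" using v(1) by (intro eq_vecI) (auto simp: cU)
  have low: "coeff (f * U) k = coeff (f * U) (2 * d - k)" if "k < d" for k
    using jury_mat_mult_vec_coeff[of d U k f 1] cU0 that v(3) vU by simp
  \<comment> \<open>The rows of the matrix give only \<open>k < d\<close>; the middle index is
    trivial and the upper half follows by symmetry.\<close>
  have sym: "coeff (f * U) k = coeff (f * U) (2 * d - k)" if "k \<le> 2 * d" for k
  proof -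
    consider "k < d" | "k = d" | "k > d" by linarith
    then show ?thesis
      using low[of k] low[of "2 * d - k"] that by cases auto
  qed
  \<comment> \<open>Since \<open>degree f = d + 1\<close>, index \<open>j - (d - 1 - m)\<close> of
    the reversal is index \<open>2 * d - j - m\<close> of \<open>f\<close>. Where either subtraction
    truncates, both sides vanish.\<close>
  have rev_term: "coeff (reflect_poly f * monom c (d - 1 - m)) j
      = jury_lower f (2 * d - j) m * c" if "m < d" "j \<le> 2 * d" for c m j
  proof -
    have "coeff (reflect_poly f * monom c (d - 1 - m)) j
        = (if d - 1 - m \<le> j then coeff (reflect_poly f) (j - (d - 1 - m)) else 0) * c"
      by (subst mult.commute) (simp add: coeff_monom_mult)
    also have "(if d - 1 - m \<le> j then coeff (reflect_poly f) (j - (d - 1 - m)) else 0)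
        = jury_lower f (2 * d - j) m"
    proof (cases "d - 1 - m \<le> j \<and> m \<le> 2 * d - j")
      case True
      then have "degree f - (j - (d - 1 - m)) = 2 * d - j - m" "j - (d - 1 - m) \<le> degree f"
        using that deg by linarith+
      then show ?thesis using True by (simp add: coeff_reflect_poly jury_lower_def)
    next
      case False
      then consider "j < d - 1 - m" | "d - 1 - m \<le> j" "2 * d - j < m" by linarith
      then show ?thesis
      proof cases
        case 1
        then have "degree f < 2 * d - j - m" using that deg by linarith
        then show ?thesis using 1 by (simp add: jury_lower_def coeff_eq_0)
      next
        case 2
        then have "degree f < j - (d - 1 - m)" using that deg by linarith
        then show ?thesis using 2 by (simp add: jury_lower_def coeff_reflect_poly)
      qed
    qed
    finally show ?thesis .
  qed
  have refl: "coeff (reflect_poly f * V) j = coeff (f * U) (2 * d - j)" if "j \<le> 2 * d" for j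
  proof -
    have "coeff (reflect_poly f * V) j = (\<Sum>m<d. jury_lower f (2 * d - j) m * coeff U m)"
      unfolding V_def sum_distrib_left coeff_sum
      using that by (intro sum.cong) (simp_all only: rev_term cU lessThan_iff if_True)
    then show ?thesis using coeff_mult_eq_sum_jury_lower[of d U f "2 * d - j"] cU0 by simp
  qed
  have degU: "degree U \<le> d - 1" by (rule degree_le) (auto simp: cU)
  have degV: "degree V \<le> d - 1"
    unfolding V_def
  proof (rule degree_sum_le)
    fix m
    show "degree (monom (v $ m) (d - 1 - m)) \<le> d - 1"
      using degree_monom_le[of "v $ m" "d - 1 - m"] by linarith
  qed simp
  \<comment> \<open>With truncated subtraction, \<open>(d + 1) + (d - 1)\<close> equals
    \<open>2 * d\<close> only for positive \<open>d\<close>.\<close>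
  have d0: "d > 0"
  proof (rule ccontr)
    assume "\<not> d > 0"
    then have "v = 0\<^sub>v d" using v(1) by (intro eq_vecI) simp_all
    then show False using v(2) by simp
  qed
  have "f * U = reflect_poly f * V"
  proof (rule poly_eqI)
    fix j
    show "coeff (f * U) j = coeff (reflect_poly f * V) j"
    proof (cases "j \<le> 2 * d")
      case True
      show ?thesis by (rule trans[OF sym[OF True] refl[OF True, symmetric]])
    next
      case False
      have "degree (f * U) \<le> 2 * d"
        using degree_mult_le[of f U] degU deg d0 by linarith
      moreover have "degree (reflect_poly f * V) \<le> 2 * d"
        using degree_mult_le[of "reflect_poly f" V] degree_reflect_poly_le[of f] degV deg d0
        by linarith
      ultimately show ?thesis using False by (simp add: coeff_eq_0)
    qed
  qed
  then have "f dvd reflect_poly f * V" by (metis dvd_triv_left)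
  then have "f dvd V"
    using coprime_reflect_poly_if_expansive[OF exp] coprime_dvd_mult_right_iff by blast
  have "V = 0"
  proof (rule ccontr)
    assume "V \<noteq> 0"
    then have "degree f \<le> degree V" by (rule dvd_imp_degree_le[OF \<open>f dvd V\<close>])
    then show False using degV deg by linarith
  qed
  have "v $ m = 0" if "m < d" for m
  proof -
    have "coeff V (d - 1 - m) = (\<Sum>i<d. if i = m then v $ i else 0)"
      unfolding V_def coeff_sum using that by (intro sum.cong) auto
    then show ?thesis using that \<open>V = 0\<close> by simp
  qed
  then have "v = 0\<^sub>v d" using v(1) by (intro eq_vecI) auto
  then show False using v(2) by simp
qed

section \<open>Scaled reversal and the singular value of s\<close>

text \<open>For nonzero t and p of degree n this is x^n p(t/x), whose nonzero roots are t divided by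
  the nonzero roots of p.\<close>

definition scaled_reflect :: "complex \<Rightarrow> complex poly \<Rightarrow> complex poly" where
  "scaled_reflect t p = reflect_poly (pcompose p [:0, t:])"

lemma scaled_reflect_mult:
  "scaled_reflect t (p * q) = scaled_reflect t p * scaled_reflect t q"
  by (simp add: scaled_reflect_def pcompose_mult reflect_poly_mult)

lemma coeff_scaled_reflect:
  assumes "t \<noteq> 0"
  shows "coeff (scaled_reflect t p) k
    = (if k \<le> degree p then t ^ (degree p - k) * coeff p (degree p - k) else 0)"
proof -
  have "degree (pcompose p [:0, t:]) = degree p" using assms by (simp add: degree_pcompose)
  then show ?thesis
    by (simp add: scaled_reflect_def coeff_reflect_poly coeff_pcompose_linear)
qed

lemma degree_scaled_reflect:
  assumes "t \<noteq> 0" "coeff p 0 \<noteq> 0"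
  shows "degree (scaled_reflect t p) = degree p"
proof -
  have "coeff (pcompose p [:0, t:]) 0 \<noteq> 0" using assms by (simp only: coeff_pcompose_linear) simp
  then show ?thesis using assms(1) by (simp add: scaled_reflect_def degree_pcompose)
qed

text \<open>The nonzero constant term keeps the degree, so both reversals are centred alike and the
  powers of t combine to \<open>t ^ degree p\<close>.\<close>

lemma scaled_reflect_scaled_reflect:
  assumes "t \<noteq> 0" "coeff p 0 \<noteq> 0"
  shows "scaled_reflect t (scaled_reflect t p) = Polynomial.smult (t ^ degree p) p"
proof (rule poly_eqI)
  fix k
  show "coeff (scaled_reflect t (scaled_reflect t p)) k = coeff (Polynomial.smult (t ^ degree p) p) k"
  proof (cases "k \<le> degree p")
    case True
    then have "t ^ degree p = t ^ (degree p - k) * t ^ k" by (simp flip: power_add)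
    then show ?thesis
      using True assms by (simp add: coeff_scaled_reflect degree_scaled_reflect)
  next
    case False
    then show ?thesis
      using assms by (simp add: coeff_scaled_reflect degree_scaled_reflect coeff_eq_0)
  qed
qed

lemma scaled_reflect_linear:
  assumes "\<beta> \<noteq> 0" "\<gamma> \<noteq> 0"
  shows "scaled_reflect (\<beta> * \<gamma>) [:- \<beta>, 1:] = Polynomial.smult (- \<beta>) [:- \<gamma>, 1:]"
  using assms by (simp add: scaled_reflect_def pcompose_pCons reflect_poly_pCons)

text \<open>Reversal with t = \<beta>\<gamma> swaps, up to constants, the two linear factors and
  also \<open>h\<close> with its reversal \<open>U\<close>. Thus \<open>f * U\<close> is
  self-reciprocal up to a constant, which makes \<open>U\<close> a kernel vector.\<close>

lemma det_jury_mat_eq_0: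
  fixes f h :: "complex poly" and \<beta> \<gamma> :: complex
  assumes f: "f = [:- \<beta>, 1:] * ([:- \<gamma>, 1:] * h)" and f0: "coeff f 0 \<noteq> 0"
    and deg: "degree f = d + 1"
  shows "Determinant.det (jury_mat f d (1 / (\<beta> * \<gamma>))) = 0"
proof -
  define t where "t = \<beta> * \<gamma>"
  have nz: "\<beta> \<noteq> 0" "\<gamma> \<noteq> 0" "coeff h 0 \<noteq> 0"
    using f0 unfolding f by (auto simp: coeff_mult_0)
  then have t0: "t \<noteq> 0" and h0: "h \<noteq> 0" by (auto simp: t_def)
  have dh: "d = Suc (degree h)"
  proof -
    have "degree ([:- \<beta>, 1:] * ([:- \<gamma>, 1:] * h)) = 1 + (1 + degree h)"
      using h0 by (simp add: degree_mult_eq del: mult_pCons_left)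
    then show ?thesis using deg unfolding f by linarith
  qed
  define U where "U = scaled_reflect t h"
  have dU: "degree U = degree h" using nz t0 by (simp add: U_def degree_scaled_reflect)
  have cU0: "coeff U m = 0" if "m \<ge> d" for m using that dU dh by (simp add: coeff_eq_0)
  have U0: "coeff U 0 \<noteq> 0"
    using t0 h0 by (simp add: U_def coeff_scaled_reflect)
  have "scaled_reflect t [:- \<gamma>, 1:] = Polynomial.smult (- \<gamma>) [:- \<beta>, 1:]"
    using scaled_reflect_linear[of \<gamma> \<beta>] nz by (simp add: t_def mult.commute)
  \<comment> \<open>The linear factors contribute (-\<beta>)(-\<gamma>) = t and the double reversal
    of \<open>h\<close> contributes \<open>t ^ degree h\<close>, in total
    \<open>t ^ d\<close>.\<close>
  then have "scaled_reflect t (f * U) = Polynomial.smult (t ^ d) (f * U)"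
    unfolding f scaled_reflect_mult U_def scaled_reflect_scaled_reflect[OF t0 nz(3)]
    using scaled_reflect_linear[OF nz(1,2)]
    by (simp add: dh t_def mult_ac del: mult_pCons_left mult_pCons_right smult_pCons)
  moreover have "degree (f * U) = 2 * d"
    using deg dU dh U0 f0 by (subst degree_mult_eq) (force, force, linarith)
  ultimately have fU: "t ^ (2 * d - k) * coeff (f * U) (2 * d - k) = t ^ d * coeff (f * U) k"
    if "k \<le> 2 * d" for k
    using coeff_scaled_reflect[OF t0, of "f * U" k] that by simp
  have "jury_mat f d (1 / t) *\<^sub>v vec d (coeff U) = 0\<^sub>v d"
  proof (rule eq_vecI)
    fix k assume "k < dim_vec (0\<^sub>v d :: complex vec)"
    then have k: "k < d" by simp
    then have "t ^ d * (t ^ (d - k) * coeff (f * U) (2 * d - k)) = t ^ d * coeff (f * U) k"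
      using fU[of k] by (simp add: mult_2 flip: mult.assoc power_add)
    then have "coeff (f * U) k = t ^ (d - k) * coeff (f * U) (2 * d - k)"
      using t0 by simp
    then have "coeff (f * U) k * (1 / t) ^ (d - k) = coeff (f * U) (2 * d - k)"
      using t0 by (simp add: power_one_over)
    then show "(jury_mat f d (1 / t) *\<^sub>v vec d (coeff U)) $ k = 0\<^sub>v d $ k"
      using jury_mat_mult_vec_coeff[OF cU0 k] k by simp
  qed (simp add: jury_mat_def)
  moreover have "vec d (coeff U) \<in> carrier_vec d" by simp
  moreover have "vec d (coeff U) \<noteq> 0\<^sub>v d"
    using U0 dh by (auto dest!: arg_cong[of _ _ "\<lambda>v. v $ 0"])
  ultimately show ?thesis
    unfolding t_def[symmetric]
    by (subst det_0_iff_vec_prod_zero[of _ d]) (simp add: jury_mat_def, blast)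
qed

section \<open>Estimates at a root and the final bounds\<close>

lemma poly_length_ge_one:
  assumes "f \<noteq> 0"
  shows "1 \<le> poly_length f"
proof -
  have "\<bar>lead_coeff f\<bar> \<le> poly_length f"
    unfolding poly_length_def by (intro member_le_sum) auto
  then show ?thesis using assms by (smt (verit) leading_coeff_0_iff)
qed

text \<open>With s = 1/|\<alpha>|, subtracting s^n f(\<alpha>) = 0 multiplies the i-th term of f(sgn
  \<alpha>) by 1 - s^(n-i), which is at most n (1 - s).\<close>

lemma norm_poly_sgn_root_le:
  fixes f :: "int poly" and \<alpha> :: complex
  assumes root: "poly (map_poly of_int f) \<alpha> = 0" and \<alpha>: "norm \<alpha> \<ge> 1"
  shows "norm (poly (map_poly of_int f) (sgn \<alpha>))
    \<le> real (degree f) * poly_length f * (1 - 1 / norm \<alpha>)"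
proof -
  define s where "s = 1 / norm \<alpha>"
  define n where "n = degree f"
  have \<alpha>0: "\<alpha> \<noteq> 0" using \<alpha> by auto
  have s: "0 < s" "s \<le> 1" using \<alpha> \<alpha>0 by (simp_all add: s_def)
  have p: "poly (map_poly of_int f) z = (\<Sum>i\<le>n. of_int (coeff f i) * z ^ i)" for z :: complex
    by (simp add: poly_altdef coeff_map_poly degree_map_poly n_def)
  have pw: "of_real s ^ n * \<alpha> ^ i = sgn \<alpha> ^ i * of_real (s ^ (n - i))" if "i \<le> n" for i
  proof -
    have "of_real s ^ n = of_real s ^ i * (of_real s ^ (n - i) :: complex)"
      using that by (simp flip: power_add)
    moreover have "of_real s * \<alpha> = sgn \<alpha>"
      by (simp add: s_def sgn_div_norm scaleR_conv_of_real divide_inverse)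
    ultimately show ?thesis by (metis mult.commute mult.left_commute of_real_power power_mult_distrib)
  qed
  have "0 = of_real s ^ n * poly (map_poly of_int f) \<alpha>" using root by simp
  also have "\<dots> = (\<Sum>i\<le>n. of_int (coeff f i) * (sgn \<alpha> ^ i * of_real (s ^ (n - i))))"
    unfolding p sum_distrib_left
    by (intro sum.cong refl) (metis atMost_iff mult.left_commute pw)
  finally have "poly (map_poly of_int f) (sgn \<alpha>)
      = (\<Sum>i\<le>n. of_int (coeff f i) * sgn \<alpha> ^ i)
        - (\<Sum>i\<le>n. of_int (coeff f i) * (sgn \<alpha> ^ i * of_real (s ^ (n - i))))"
    by (simp add: p)
  also have "\<dots> = (\<Sum>i\<le>n. of_int (coeff f i) * (sgn \<alpha> ^ i * of_real (1 - s ^ (n - i))))"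
    by (simp add: sum_subtractf algebra_simps)
  also have "norm \<dots> \<le> (\<Sum>i\<le>n. \<bar>real_of_int (coeff f i)\<bar> * (real n * (1 - s)))"
  proof (rule order.trans[OF norm_sum], rule sum_mono)
    fix i
    have "1 - s ^ (n - i) \<le> real (n - i) * (1 - s)"
      using s by (intro one_minus_power_le) auto
    also have "\<dots> \<le> real n * (1 - s)"
      using s by (intro mult_right_mono) auto
    finally have "1 - s ^ (n - i) \<le> real n * (1 - s)" .
    moreover have "0 \<le> 1 - s ^ (n - i)" using s by (simp add: power_le_one)
    moreover have "norm (of_real (1 - s ^ (n - i)) :: complex) = \<bar>1 - s ^ (n - i)\<bar>"
      by (rule norm_of_real)
    ultimately show "norm (of_int (coeff f i) * (sgn \<alpha> ^ i * of_real (1 - s ^ (n - i))))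
        \<le> \<bar>real_of_int (coeff f i)\<bar> * (real n * (1 - s))"
      using \<alpha>0 by (simp add: norm_mult norm_power norm_sgn mult_left_mono del: of_real_diff)
  qed
  also have "\<dots> = real n * poly_length f * (1 - s)"
    by (simp add: poly_length_def n_def flip: sum_distrib_right)
  finally show ?thesis by (simp add: n_def s_def)
qed

text \<open>Applied with \<open>r\<close> equal to |\<alpha>| in the real case and to its square in
  the nonreal case.\<close>

lemma inverse_gap_le:
  fixes r c :: real
  assumes "r > 1" "1 \<le> c * (1 - 1 / r)"
  shows "1 / (r - 1) \<le> c"
proof -
  have "r \<le> c * (r - 1)" using assms by (simp add: field_simps)
  then show ?thesis using assms by (simp add: pos_divide_le_eq)
qed

lemma nonreal_root_bound:
  fixes f :: "int poly" and \<alpha> :: complex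
  assumes deg: "degree f = d + 1" and exp: "expansive (map_poly of_int f)"
    and root: "poly (map_poly of_int f) \<alpha> = 0" and nr: "\<alpha> \<notin> \<real>"
  shows "1 \<le> real (Suc d choose 2) * real_of_int (poly_length f) ^ d * (1 - 1 / (norm \<alpha>)\<^sup>2)"
proof -
  define F where "F = (map_poly of_int f :: complex poly)"
  define s where "s = 1 / (norm \<alpha>)\<^sup>2"
  have cF: "coeff F i = of_int (coeff f i)" for i by (simp add: F_def coeff_map_poly)
  have dF: "degree F = d + 1" by (simp add: F_def degree_map_poly deg)
  have \<alpha>1: "norm \<alpha> > 1" using exp root by (simp add: expansive_def)
  have s: "0 < s" "s \<le> 1" using \<alpha>1 by (auto simp: s_def divide_simps)
  have F0: "coeff F 0 \<noteq> 0"
    using exp by (auto simp: expansive_def F_def[symmetric] poly_0_coeff_0[symmetric])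
  have "poly F (cnj \<alpha>) = cnj (poly F \<alpha>)"
    by (simp add: poly_altdef cF)
  then have roots: "poly F \<alpha> = 0" "poly F (cnj \<alpha>) = 0" using root by (simp_all add: F_def)
  obtain g where g: "F = [:- \<alpha>, 1:] * g" using roots(1) by (metis poly_eq_0_iff_dvd dvdE)
  have "cnj \<alpha> \<noteq> \<alpha>" using nr by (simp add: Reals_cnj_iff)
  then have "poly g (cnj \<alpha>) = 0" using roots(2) by (simp add: g)
  then obtain h where "g = [:- cnj \<alpha>, 1:] * h" by (metis poly_eq_0_iff_dvd dvdE)
  then have Fh: "F = [:- \<alpha>, 1:] * ([:- cnj \<alpha>, 1:] * h)" using g by simp
  have s_eq: "1 / (\<alpha> * cnj \<alpha>) = of_real s"
    by (simp add: s_def complex_norm_square[symmetric])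
  have D0: "Determinant.det (jury_mat F d (of_real s)) = 0"
    using det_jury_mat_eq_0[OF Fh F0 dF] s_eq by simp
  \<comment> \<open>At s = 1 the entries are integers, so a nonzero determinant has norm at least
    1.\<close>
  have "jury_mat F d 1 = map_mat of_int (jury_mat f d 1)"
    by (rule eq_matI) (auto simp: jury_mat_def jury_lower_def cF)
  then have "Determinant.det (jury_mat F d 1) = of_int (Determinant.det (jury_mat f d 1))"
    by simp
  moreover have "Determinant.det (jury_mat F d 1) \<noteq> 0"
    using det_jury_mat_one_nonzero[of F d] exp dF by (simp add: F_def)
  ultimately have D1: "1 \<le> norm (Determinant.det (jury_mat F d 1))" by simp
  have "norm (Determinant.det (mat d d (\<lambda>(k, m). jury_lower F k m - coeff F (2 * d - k - m)))
      - Determinant.det (mat d d (\<lambda>(k, m). jury_lower F k m * of_real s ^ (d - k)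
          - coeff F (2 * d - k - m))))
     \<le> (\<Sum>k<d. norm (1 - of_real s ^ (d - k) :: complex)) * real_of_int (poly_length f) ^ d"
  proof (rule norm_det_scaled_diff_le)
    fix k assume "k < d"
    show "norm (of_real s ^ (d - k) :: complex) \<le> 1"
      using s by (simp add: norm_power power_le_one)
  next
    fix m assume m: "m < d"
    have "(\<Sum>k<d. norm (jury_lower F k m) + norm (coeff F (2 * d - k - m)))
        = of_int (\<Sum>k<d. \<bar>jury_lower f k m\<bar> + \<bar>coeff f (2 * d - k - m)\<bar>)"
      unfolding of_int_sum by (intro sum.cong) (auto simp: cF jury_lower_def)
    also have "\<dots> \<le> poly_length f"
      using jury_column_sum_le[OF m, of f] deg by linarith
    finally show "(\<Sum>k<d. norm (jury_lower F k m) + norm (coeff F (2 * d - k - m)))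
        \<le> real_of_int (poly_length f)" .
  qed
  then have "1 \<le> (\<Sum>k<d. norm (1 - of_real s ^ (d - k) :: complex)) * real_of_int (poly_length f) ^ d"
    using D0 D1 by (simp add: jury_mat_def)
  also have "\<dots> \<le> (\<Sum>k<d. real (d - k) * (1 - s)) * real_of_int (poly_length f) ^ d"
  proof (intro mult_right_mono sum_mono)
    fix k
    have "norm (1 - of_real s ^ (d - k) :: complex) = norm (of_real (1 - s ^ (d - k)) :: complex)"
      by simp
    also have "\<dots> = 1 - s ^ (d - k)"
      using s by (subst norm_of_real) (simp add: power_le_one)
    finally show "norm (1 - of_real s ^ (d - k) :: complex) \<le> real (d - k) * (1 - s)"
      using one_minus_power_le[of s "d - k"] s by simp
  next
    have "f \<noteq> 0" using deg by auto
    then show "0 \<le> real_of_int (poly_length f) ^ d" using poly_length_ge_one[of f] by simp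
  qed
  also have "(\<Sum>k<d. real (d - k) * (1 - s)) = real (Suc d choose 2) * (1 - s)"
  proof -
    have "(\<Sum>k<d. d - k) = (\<Sum>k\<le>d. k)"
      by (induction d) (simp_all add: sum.lessThan_Suc_shift del: sum.lessThan_Suc)
    also have "\<dots> = Suc d choose 2"
      by (induction d) (auto simp: numeral_2_eq_2)
    finally show ?thesis by (metis of_nat_sum sum_distrib_right)
  qed
  finally show ?thesis by (simp add: s_def mult_ac)
qed

theorem theorem4p6:
  fixes f :: "int poly" and n :: nat and \<alpha> :: complex
  assumes "degree f = n" and "n \<ge> 1"
    and "expansive (map_poly of_int f)"
    and "poly (map_poly of_int f) \<alpha> = 0"
  shows "1 / (norm \<alpha> - 1) \<le>
    (if \<alpha> \<in> \<real>
     then real n * real_of_int (poly_length f) + real n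
     else 2 * real (n choose 2) * real_of_int (poly_length f) ^ (n - 1)
            + 2 * real (n choose 2) + 1)"
proof -
  have \<alpha>1: "norm \<alpha> > 1" using assms by (simp add: expansive_def)
  show ?thesis
  proof (cases "\<alpha> \<in> \<real>")
    case True
    then obtain x where x: "\<alpha> = of_real x" by (auto elim: Reals_cases)
    have x0: "x \<noteq> 0" using \<alpha>1 x by auto
    have sgn: "sgn \<alpha> = of_int (if x > 0 then 1 else -1)"
      using x0 by (simp add: x sgn_of_real sgn_if)
    \<comment> \<open>\<open>sgn \<alpha>\<close> has norm 1, whereas all roots have norm greater
      than 1.\<close>
    have "poly (map_poly of_int f) (sgn \<alpha>) \<noteq> 0"
      using assms(3) \<alpha>1 by (auto simp: expansive_def norm_sgn dest!: spec[of _ "sgn \<alpha>"] split: if_splits)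
    moreover have "poly (map_poly of_int f) (sgn \<alpha>)
        = (of_int (poly f (if x > 0 then 1 else -1)) :: complex)"
      unfolding sgn by (simp add: poly_altdef coeff_map_poly degree_map_poly)
    ultimately have "1 \<le> norm (poly (map_poly of_int f) (sgn \<alpha>))" by simp
    also have "\<dots> \<le> real n * poly_length f * (1 - 1 / norm \<alpha>)"
      using norm_poly_sgn_root_le[of f \<alpha>] assms \<alpha>1 by simp
    finally have "1 / (norm \<alpha> - 1) \<le> real n * poly_length f"
      using \<alpha>1 by (intro inverse_gap_le)
    then show ?thesis using True by simp
  next
    case False
    define N where "N = real (n choose 2) * real_of_int (poly_length f) ^ (n - 1)"
    have "1 \<le> N * (1 - 1 / (norm \<alpha>)\<^sup>2)"
      using nonreal_root_bound[of f "n - 1" \<alpha>] assms False by (simp add: N_def)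
    then have N: "1 / ((norm \<alpha>)\<^sup>2 - 1) \<le> N"
      using \<alpha>1 by (intro inverse_gap_le) auto
    \<comment> \<open>Partial fractions pass from |\<alpha>|^2 - 1 to |\<alpha>| - 1; the last term
      is at most 1 and yields the summand 1 of the bound.\<close>
    have "1 / (norm \<alpha> - 1) = 2 * (1 / ((norm \<alpha>)\<^sup>2 - 1)) + 1 / (norm \<alpha> + 1)"
    proof -
      have "(norm \<alpha>)\<^sup>2 - 1 = (norm \<alpha> - 1) * (norm \<alpha> + 1)"
        by (simp add: power2_eq_square algebra_simps)
      then show ?thesis using \<alpha>1 by (simp add: divide_simps) (simp add: algebra_simps)
    qed
    also have "\<dots> \<le> 2 * N + 1" using N \<alpha>1 by (intro add_mono mult_left_mono) auto
    finally show ?thesis using False by (simp add: N_def)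
  qed
qed

end
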